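(* Let $c>0$, $n\ge1$, $r\in\mathbb{R}$, and let $\bm{z}\in\mathbb{R}^n$ (identified with the tangent space of $\mathbb{B}^n_c$ at $\bm{0}$) be nonzero. Put $[\bm{z}]=\bm{z}/\|\bm{z}\|$, $\bm{q}=\frac{1}{\sqrt c}\tanh(\sqrt c\,r)\,[\bm{z}]\in\mathbb{B}^n_c$ and $\bm{a}=\operatorname{sech}^2(\sqrt c\,r)\,\bm{z}$, and let $$\bar H=\{\bm{w}\in\mathbb{B}^n_c:\ \langle\bm{a},\,(-\bm{q})\oplus_c\bm{w}\rangle=0\}.$$ For $\bm{x}\in\mathbb{B}^n_c$ define $$v(\bm{x})=\operatorname{sign}\left(\langle\bm{a},(-\bm{q})\oplus_c\bm{x}\rangle\right)\,d_c(\bm{x},\bar H)\,\lambda^c_{\bm{q}}\|\bm{a}\|.$$ Then for every $\bm{x}\in\mathbb{B}^n_c$, $$v(\bm{x})=\frac{2\|\bm{z}\|}{\sqrt c}\,\sinh^{-1}\left(\lambda^c_{\bm{x}}\,\langle\sqrt c\,\bm{x},[\bm{z}]\rangle\cosh(2\sqrt c\,r)-(\lambda^c_{\bm{x}}-1)\sinh(2\sqrt c\,r)\right).$$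
   Context: $\|\cdot\|$ and $\langle\cdot,\cdot\rangle$ are the Euclidean norm and inner product on $\mathbb{R}^n$, and $\operatorname{sign}(0)=0$. The Poincaré ball of curvature $-c$ is $\mathbb{B}^n_c=\{\bm{x}\in\mathbb{R}^n: c\|\bm{x}\|^2<1\}$ with conformal factor $\lambda^c_{\bm{x}}=2/(1-c\|\bm{x}\|^2)$. Möbius addition on $\mathbb{B}^n_c$ is $$\bm{x}\oplus_c\bm{y}=\frac{(1+2c\langle\bm{x},\bm{y}\rangle+c\|\bm{y}\|^2)\bm{x}+(1-c\|\bm{x}\|^2)\bm{y}}{1+2c\langle\bm{x},\bm{y}\rangle+c^2\|\bm{x}\|^2\|\bm{y}\|^2}.$$ The hyperbolic distance is $d_c(\bm{x},\bm{y})=\frac{2}{\sqrt c}\tanh^{-1}\left(\sqrt c\,\|(-\bm{x})\oplus_c\bm{y}\|\right)$, and for a nonempty subset $H\subset\mathbb{B}^n_c$, $d_c(\bm{x},H)=\inf_{\bm{w}\in H}d_c(\bm{x},\bm{w})$. In Riemannian terms, $\bm{q}$ is the image of $r[\bm{z}]$ under the exponential map at $\bm{0}$, $\bm{a}$ is the parallel transport of $\bm{z}$ from $\bm{0}$ to $\bm{q}$ along the geodesic, $\bar H$ is the union of all geodesics through $\bm{q}$ orthogonal to $\bm{a}$, and $\lambda^c_{\bm{q}}\|\bm{a}\|$ is the Riemannian norm of $\bm{a}$ at $\bm{q}$. *)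

theory Defs
  imports "HOL-Analysis.Analysis"
begin

text \<open>All notions take the parameter \<open>c\<close> of the ball of curvature \<open>- c\<close> explicitly; they are meant for
  \<open>c > 0\<close> and for points of \<open>poincare_ball c\<close>.\<close>

definition poincare_ball :: "real \<Rightarrow> 'a::real_inner set" where
  "poincare_ball c = {x. c * (norm x)\<^sup>2 < 1}"

definition conformal_factor :: "real \<Rightarrow> 'a::real_inner \<Rightarrow> real" where
  "conformal_factor c x = 2 / (1 - c * (norm x)\<^sup>2)"

definition mobius_add :: "real \<Rightarrow> 'a::real_inner \<Rightarrow> 'a \<Rightarrow> 'a" where
  "mobius_add c x y =
     ((1 + 2 * c * (x \<bullet> y) + c * (norm y)\<^sup>2) *\<^sub>R x + (1 - c * (norm x)\<^sup>2) *\<^sub>R y) /\<^sub>R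
     (1 + 2 * c * (x \<bullet> y) + c\<^sup>2 * (norm x)\<^sup>2 * (norm y)\<^sup>2)"

definition hyp_dist :: "real \<Rightarrow> 'a::real_inner \<Rightarrow> 'a \<Rightarrow> real" where
  "hyp_dist c x y = 2 / sqrt c * artanh (sqrt c * norm (mobius_add c (- x) y))"

text \<open>The infimum is taken in the reals, so it is meaningful only for nonempty \<open>H\<close>.\<close>

definition hyp_setdist :: "real \<Rightarrow> 'a::real_inner \<Rightarrow> 'a set \<Rightarrow> real" where
  "hyp_setdist c x H = (INF w\<in>H. hyp_dist c x w)"

definition poincare_hyperplane :: "real \<Rightarrow> 'a::real_inner \<Rightarrow> 'a \<Rightarrow> 'a set" where
  "poincare_hyperplane c q a = {w \<in> poincare_ball c. a \<bullet> mobius_add c (- q) w = 0}"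

lemma base_point_in_ball:
  fixes z :: "'a::real_inner"
  assumes "c > 0" "z \<noteq> 0"
  shows "(1 / sqrt c * tanh (sqrt c * r)) *\<^sub>R (z /\<^sub>R norm z) \<in> poincare_ball c"
proof -
  have "(tanh (sqrt c * r))\<^sup>2 < 1"
    using tanh_real_bounds[of "sqrt c * r"] by (simp add: abs_square_less_1 abs_less_iff)
  then show ?thesis
    using assms by (simp add: poincare_ball_def power_mult_distrib power_divide field_simps)
qed

lemma base_point_in_hyperplane:
  assumes "q \<in> poincare_ball c"
  shows "q \<in> poincare_hyperplane c q a"
proof -
  have "mobius_add c (- q) q = 0"
    by (simp add: mobius_add_def dot_square_norm algebra_simps)
  then show ?thesis
    using assms by (simp add: poincare_hyperplane_def)
qed

end

(* In hyperboloid coordinates (time, space) = (lambda - 1, sqrt c lambda x) the distance is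
   arcosh / sqrt c of the Lorentz product. A boost by 2 sqrt c r in the direction z turns the hyperplane into
   the vanishing set of a single coordinate S, which is the argument of arsinh in the theorem.
   Cauchy-Schwarz bounds the Lorentz product of x with any point of the hyperplane below by
   sqrt (1 + S(x)^2) = cosh (arsinh |S(x)|), with equality at the foot of the perpendicular. *)

theory Submission
  imports Defs
begin

section \<open>Hyperboloid coordinates on the ball\<close>

definition time_coord :: "real \<Rightarrow> 'a::real_inner \<Rightarrow> real" where
  "time_coord c x = conformal_factor c x - 1"

text \<open>Paired with \<open>time_coord\<close>, this is inverse stereographic projection of the
  rescaled ball onto the upper sheet of the unit hyperboloid.\<close>

definition space_coord :: "real \<Rightarrow> 'a::real_inner \<Rightarrow> 'a" where
  "space_coord c x = (sqrt c * conformal_factor c x) *\<^sub>R x"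

lemma time_coord_eq:
  assumes "x \<in> poincare_ball c"
  shows "time_coord c x = (1 + c * (norm x)\<^sup>2) / (1 - c * (norm x)\<^sup>2)"
  using assms by (simp add: poincare_ball_def time_coord_def conformal_factor_def field_simps)

lemma time_coord_pos:
  assumes "c > 0" "x \<in> poincare_ball c"
  shows "0 < time_coord c x"
  using assms by (simp add: time_coord_eq poincare_ball_def add_pos_nonneg)

text \<open>With lambda the conformal factor, c |x|^2 = 1 - 2 / lambda, so c lambda^2 |x|^2 =
  lambda^2 - 2 lambda = (lambda - 1)^2 - 1.\<close>

lemma space_coord_norm:
  assumes "c > 0" "x \<in> poincare_ball c"
  shows "(norm (space_coord c x))\<^sup>2 = (time_coord c x)\<^sup>2 - 1"
proof -
  have "1 - c * (norm x)\<^sup>2 \<noteq> 0"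
    using assms(2) by (simp add: poincare_ball_def)
  then show ?thesis
    using assms(1)
    by (simp add: space_coord_def time_coord_def conformal_factor_def power_mult_distrib
        power_divide divide_simps) (simp add: power2_eq_square algebra_simps)
qed

section \<open>Hyperbolic distance as a Lorentz product\<close>

lemma mobius_denominator_pos:
  assumes "c > 0" "x \<in> poincare_ball c" "y \<in> poincare_ball c"
  shows "0 < 1 + 2 * c * (x \<bullet> y) + c\<^sup>2 * (norm x)\<^sup>2 * (norm y)\<^sup>2"
proof -
  have "(c * (norm x * norm y))\<^sup>2 = (c * (norm x)\<^sup>2) * (c * (norm y)\<^sup>2)"
    by (simp add: power2_eq_square)
  also have "\<dots> < 1 * 1"
    using assms by (intro mult_strict_mono) (auto simp: poincare_ball_def)
  finally have "c * (norm x * norm y) < 1"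
    using power2_less_imp_less[of "c * (norm x * norm y)" 1] by simp
  then have "0 < (1 - c * (norm x * norm y))\<^sup>2"
    by simp
  \<comment> \<open>By Cauchy-Schwarz the denominator is at least the square (1 - c |x| |y|)^2, just
    shown to be positive.\<close>
  moreover have "- (c * (norm x * norm y)) \<le> c * (x \<bullet> y)"
    using assms(1) Cauchy_Schwarz_ineq2[of x y]
      mult_left_mono[of "- (x \<bullet> y)" "norm x * norm y" c] by (simp add: abs_le_iff)
  ultimately show ?thesis
    by (simp add: power2_eq_square algebra_simps)
qed

lemma minus_in_poincare_ball: "x \<in> poincare_ball c \<Longrightarrow> - x \<in> poincare_ball c"
  by (simp add: poincare_ball_def)

text \<open>The squared norm of the numerator of the Moebius sum is itself divisible by the
  denominator \<open>D\<close>, with quotient |x - y|^2, so one of the two factors \<open>D\<close>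
  cancels.\<close>

lemma norm_mobius_add_minus:
  assumes "c > 0" "x \<in> poincare_ball c" "y \<in> poincare_ball c"
  shows "(norm (mobius_add c (- x) y))\<^sup>2 =
    (norm (x - y))\<^sup>2 / (1 - 2 * c * (x \<bullet> y) + c\<^sup>2 * (norm x)\<^sup>2 * (norm y)\<^sup>2)"
proof -
  define D where "D = 1 - 2 * c * (x \<bullet> y) + c\<^sup>2 * (norm x)\<^sup>2 * (norm y)\<^sup>2"
  have D: "D > 0"
    using mobius_denominator_pos[OF assms(1) minus_in_poincare_ball[OF assms(2)] assms(3)]
    by (simp add: D_def)
  define N where "N = (1 + 2 * c * (- x \<bullet> y) + c * (norm y)\<^sup>2) *\<^sub>R (- x) + (1 - c * (norm x)\<^sup>2) *\<^sub>R y"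
  have "(norm N)\<^sup>2 = D * (norm (x - y))\<^sup>2"
    unfolding N_def D_def power2_norm_eq_inner
    by (simp add: inner_add_left inner_add_right inner_diff_left inner_diff_right inner_commute[of y x])
       (simp add: power2_eq_square algebra_simps)
  moreover have "mobius_add c (- x) y = N /\<^sub>R D"
    by (simp add: mobius_add_def N_def D_def)
  ultimately show ?thesis
    using D unfolding D_def[symmetric]
    by (simp add: power_mult_distrib power_divide divide_simps power2_eq_square)
qed

text \<open>Double-angle formula: for m = tanh t the fraction is cosh (2 t), and the square root in
  the logarithmic form of \<open>arcosh\<close> is sinh (2 t) = 2 m / (1 - m^2).\<close>

lemma two_artanh_eq_arcosh:
  fixes m :: real
  assumes "0 \<le> m" "m < 1"
  shows "2 * artanh m = arcosh ((1 + m\<^sup>2) / (1 - m\<^sup>2))"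
proof -
  have m2: "m\<^sup>2 < 1"
    using assms by (simp add: abs_square_less_1)
  have eq: "((1 + m\<^sup>2) / (1 - m\<^sup>2))\<^sup>2 - 1 = (2 * m / (1 - m\<^sup>2))\<^sup>2"
    using m2 by (simp add: power_divide divide_simps) (simp add: power2_eq_square algebra_simps)
  have "arcosh ((1 + m\<^sup>2) / (1 - m\<^sup>2)) = ln ((1 + m\<^sup>2) / (1 - m\<^sup>2) + 2 * m / (1 - m\<^sup>2))"
    using assms m2 by (subst arcosh_real_def) (simp_all add: eq real_sqrt_abs abs_mult)
  also have "(1 + m\<^sup>2) / (1 - m\<^sup>2) + 2 * m / (1 - m\<^sup>2) = (1 + m)\<^sup>2 / ((1 - m) * (1 + m))"
    by (simp add: add_divide_distrib[symmetric] power2_eq_square algebra_simps)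
  also have "\<dots> = (1 + m) / (1 - m)"
    using assms by (simp add: power2_eq_square)
  finally show ?thesis
    by (simp add: artanh_def)
qed

text \<open>Doubling \<open>artanh\<close> produces (1 + m^2) / (1 - m^2), in which \<open>D\<close>
  cancels; what remains is the Lorentz product of the two points.\<close>

lemma hyp_dist_eq_arcosh:
  assumes "c > 0" "x \<in> poincare_ball c" "y \<in> poincare_ball c"
  shows "hyp_dist c x y = arcosh (time_coord c x * time_coord c y - space_coord c x \<bullet> space_coord c y) / sqrt c"
proof -
  define D where "D = 1 - 2 * c * (x \<bullet> y) + c\<^sup>2 * (norm x)\<^sup>2 * (norm y)\<^sup>2"
  have D: "D > 0"
    using mobius_denominator_pos[OF assms(1) minus_in_poincare_ball[OF assms(2)] assms(3)]
    by (simp add: D_def)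
  define m where "m = sqrt c * norm (mobius_add c (- x) y)"
  have m2: "m\<^sup>2 = c * (norm (x - y))\<^sup>2 / D"
    using assms by (simp add: m_def power_mult_distrib norm_mobius_add_minus D_def)
  have pos: "0 < 1 - c * (norm x)\<^sup>2" "0 < 1 - c * (norm y)\<^sup>2"
    using assms by (simp_all add: poincare_ball_def)
  have norm_diff: "(norm (x - y))\<^sup>2 = (norm x)\<^sup>2 + (norm y)\<^sup>2 - 2 * (x \<bullet> y)"
    unfolding power2_norm_eq_inner by (simp add: inner_diff inner_commute)
  \<comment> \<open>This factorization serves twice: it gives \<open>m < 1\<close>, and it splits
    the denominator into one factor for each point, as in the two conformal factors.\<close>
  have minus: "D - c * (norm (x - y))\<^sup>2 = (1 - c * (norm x)\<^sup>2) * (1 - c * (norm y)\<^sup>2)"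
    unfolding D_def norm_diff by (simp add: power2_eq_square algebra_simps)
  have "1 - m\<^sup>2 = (D - c * (norm (x - y))\<^sup>2) / D"
    using D by (simp add: m2 field_simps)
  then have one_minus: "1 - m\<^sup>2 = (1 - c * (norm x)\<^sup>2) * (1 - c * (norm y)\<^sup>2) / D"
    by (simp add: minus)
  then have "0 < 1 - m\<^sup>2"
    using pos D by simp
  then have "m < 1"
    using power2_less_imp_less[of m 1] by simp
  moreover have "0 \<le> m"
    using assms by (simp add: m_def)
  ultimately have artanh: "2 * artanh m = arcosh ((1 + m\<^sup>2) / (1 - m\<^sup>2))"
    by (intro two_artanh_eq_arcosh)
  have "1 + m\<^sup>2 = (D + c * (norm (x - y))\<^sup>2) / D"
    using D by (simp add: m2 field_simps)
  then have "(1 + m\<^sup>2) / (1 - m\<^sup>2) =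
      (D + c * (norm (x - y))\<^sup>2) / ((1 - c * (norm x)\<^sup>2) * (1 - c * (norm y)\<^sup>2))"
    using D by (simp add: one_minus)
  also have "\<dots> = ((1 + c * (norm x)\<^sup>2) * (1 + c * (norm y)\<^sup>2) - 4 * c * (x \<bullet> y))
      / ((1 - c * (norm x)\<^sup>2) * (1 - c * (norm y)\<^sup>2))"
    unfolding D_def norm_diff by (simp add: power2_eq_square algebra_simps)
  also have "\<dots> = time_coord c x * time_coord c y - space_coord c x \<bullet> space_coord c y"
  proof -
    have "space_coord c x \<bullet> space_coord c y =
        (sqrt c * sqrt c) * (conformal_factor c x * conformal_factor c y) * (x \<bullet> y)"
      by (simp add: space_coord_def)
    also have "\<dots> = 4 * c * (x \<bullet> y) / ((1 - c * (norm x)\<^sup>2) * (1 - c * (norm y)\<^sup>2))"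
      using assms(1) by (simp add: conformal_factor_def)
    finally show ?thesis
      by (simp add: time_coord_eq[OF assms(2)] time_coord_eq[OF assms(3)] diff_divide_distrib)
  qed
  finally show ?thesis
    using artanh by (simp add: hyp_dist_def m_def)
qed

text \<open>Needed to turn a foot point constructed on the hyperboloid into a point of the
  ball.\<close>

lemma hyperboloid_chart_surj:
  fixes p :: "'a::real_inner"
  assumes "c > 0" "t > 0" "(norm p)\<^sup>2 = t\<^sup>2 - 1"
  obtains x where "x \<in> poincare_ball c" "time_coord c x = t" "space_coord c x = p"
proof -
  \<comment> \<open>Stereographic projection: time t forces the conformal factor to be 1 + t, and
    the space coordinate is then solved for x.\<close>
  define x where "x = (1 / (sqrt c * (1 + t))) *\<^sub>R p"
  have "c * (norm x)\<^sup>2 = (t\<^sup>2 - 1) / (1 + t)\<^sup>2"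
    using assms by (simp add: x_def power_mult_distrib power_divide)
  also have "\<dots> = (t - 1) / (t + 1)"
    using assms by (simp add: divide_simps) (simp add: power2_eq_square algebra_simps)
  finally have cn: "c * (norm x)\<^sup>2 = (t - 1) / (t + 1)" .
  have cf: "conformal_factor c x = t + 1"
    unfolding conformal_factor_def cn using assms by (simp add: field_simps)
  show ?thesis
  proof
    show "x \<in> poincare_ball c"
      unfolding poincare_ball_def mem_Collect_eq cn using assms by simp
    show "time_coord c x = t"
      by (simp add: time_coord_def cf)
    show "space_coord c x = p"
      unfolding space_coord_def cf using assms by (simp add: x_def add.commute)
  qed
qed

section \<open>Two facts about arcosh\<close>

lemma arcosh_mono:
  fixes x y :: real
  assumes "1 \<le> x" "x \<le> y"
  shows "arcosh x \<le> arcosh y"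
  using assms arcosh_real_strict_mono[of x y] by (auto simp: less_eq_real_def)

text \<open>Both sides are the logarithm of sqrt (1 + s^2) + |s|.\<close>

lemma arcosh_sqrt_one_plus_square:
  fixes s :: real
  shows "arcosh (sqrt (1 + s\<^sup>2)) = arsinh \<bar>s\<bar>"
  by (simp add: arcosh_real_def arsinh_real_def add.commute)

section \<open>Coordinates after a Lorentz boost\<close>

definition signed_height :: "real \<Rightarrow> real \<Rightarrow> 'a::real_inner \<Rightarrow> 'a \<Rightarrow> real" where
  "signed_height c b u x = cosh b * (space_coord c x \<bullet> u) - sinh b * time_coord c x"

text \<open>For a unit vector \<open>u\<close>, this and \<open>signed_height\<close> are the time
  component and the component along \<open>u\<close> after a boost of rapidity \<open>b\<close> in
  the plane of time and \<open>u\<close>; \<open>transverse\<close> is the part orthogonal to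
  \<open>u\<close>, which the boost fixes.\<close>

definition boosted_time :: "real \<Rightarrow> real \<Rightarrow> 'a::real_inner \<Rightarrow> 'a \<Rightarrow> real" where
  "boosted_time c b u x = cosh b * time_coord c x - sinh b * (space_coord c x \<bullet> u)"

definition transverse :: "real \<Rightarrow> 'a::real_inner \<Rightarrow> 'a \<Rightarrow> 'a" where
  "transverse c u x = space_coord c x - (space_coord c x \<bullet> u) *\<^sub>R u"

text \<open>A boost preserves the open future cone: |sinh b| < cosh b, and the component along
  \<open>u\<close> is smaller in absolute value than the time coordinate.\<close>

lemma boosted_time_pos:
  fixes u :: "'a::real_inner"
  assumes "c > 0" "norm u = 1" "x \<in> poincare_ball c"
  shows "0 < boosted_time c b u x"
proof -
  have "\<bar>space_coord c x \<bullet> u\<bar> \<le> norm (space_coord c x)"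
    using Cauchy_Schwarz_ineq2[of "space_coord c x" u] assms by simp
  also have "\<dots> < time_coord c x"
    using space_coord_norm[OF assms(1,3)] time_coord_pos[OF assms(1,3)]
    by (simp add: power2_less_imp_less)
  finally have "\<bar>space_coord c x \<bullet> u\<bar> < time_coord c x" .
  moreover have "\<bar>sinh b\<bar> < cosh b"
    by (rule power2_less_imp_less) (simp_all add: cosh_square_eq)
  ultimately have "\<bar>sinh b\<bar> * \<bar>space_coord c x \<bullet> u\<bar> < cosh b * time_coord c x"
    by (intro mult_strict_mono') auto
  then show ?thesis
    by (simp add: boosted_time_def abs_mult[symmetric] abs_less_iff)
qed

text \<open>The boost is a Lorentz isometry: the transverse part splits off orthogonally, and in the
  remaining plane the form is multiplied by cosh^2 - sinh^2 = 1.\<close>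

lemma lorentz_form_boost:
  fixes u :: "'a::real_inner"
  assumes "norm u = 1"
  shows "time_coord c x * time_coord c y - space_coord c x \<bullet> space_coord c y =
    boosted_time c b u x * boosted_time c b u y - signed_height c b u x * signed_height c b u y
      - transverse c u x \<bullet> transverse c u y"
proof -
  have uu: "u \<bullet> u = 1"
    using assms by (simp add: norm_eq_1)
  define X Y where "X = space_coord c x \<bullet> u" and "Y = space_coord c y \<bullet> u"
  define s t where "s = time_coord c x" and "t = time_coord c y"
  have "transverse c u x \<bullet> transverse c u y = space_coord c x \<bullet> space_coord c y - X * Y"
    by (simp add: transverse_def X_def Y_def inner_diff uu inner_commute)
  moreover have "boosted_time c b u x * boosted_time c b u y - signed_height c b u x * signed_height c b u y
      = ((cosh b)\<^sup>2 - (sinh b)\<^sup>2) * (s * t - X * Y)"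
    by (simp add: boosted_time_def signed_height_def X_def Y_def s_def t_def power2_eq_square algebra_simps)
  ultimately show ?thesis
    by (simp add: cosh_square_eq s_def t_def)
qed

text \<open>The case \<open>y = x\<close> of \<open>lorentz_form_boost\<close>, where the Lorentz
  product is 1.\<close>

lemma boosted_time_square:
  fixes u :: "'a::real_inner"
  assumes "c > 0" "norm u = 1" "x \<in> poincare_ball c"
  shows "(boosted_time c b u x)\<^sup>2 = 1 + (signed_height c b u x)\<^sup>2 + (norm (transverse c u x))\<^sup>2"
  using lorentz_form_boost[OF assms(2), of c x x b] space_coord_norm[OF assms(1,3)]
  by (simp add: power2_norm_eq_inner) (simp add: power2_eq_square)

section \<open>Distance to the zero set of the signed height\<close>

lemma arsinh_le_hyp_dist:
  fixes u :: "'a::real_inner"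
  assumes "c > 0" "norm u = 1" "x \<in> poincare_ball c" "w \<in> poincare_ball c" "signed_height c b u w = 0"
  shows "arsinh \<bar>signed_height c b u x\<bar> / sqrt c \<le> hyp_dist c x w"
proof -
  define T T' where "T = boosted_time c b u x" and "T' = boosted_time c b u w"
  define p p' where "p = norm (transverse c u x)" and "p' = norm (transverse c u w)"
  define k where "k = sqrt (1 + (signed_height c b u x)\<^sup>2)"
  have k: "k \<ge> 1" "k\<^sup>2 = 1 + (signed_height c b u x)\<^sup>2"
    by (simp_all add: k_def)
  have T: "0 < T" "0 < T'" "T\<^sup>2 = k\<^sup>2 + p\<^sup>2" "T'\<^sup>2 = 1 + p'\<^sup>2"
    using boosted_time_pos[OF assms(1,2)] boosted_time_square[OF assms(1,2)] assms(3-5)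
    by (simp_all add: T_def T'_def p_def p'_def k)
  \<comment> \<open>Lagrange's identity for the plane vectors (k, p) and (1, p'), whose lengths are
    \<open>T\<close> and \<open>T'\<close>. The remainder vanishes when p' = p / k, which suggests
    the foot of the perpendicular.\<close>
  have "(T * T')\<^sup>2 - (k + p * p')\<^sup>2 = (k * p' - p)\<^sup>2"
    unfolding power_mult_distrib T(3,4) by (simp add: power2_eq_square algebra_simps)
  then have "(k + p * p')\<^sup>2 \<le> (T * T')\<^sup>2"
    by (metis diff_ge_0_iff_ge zero_le_power2)
  then have "k + p * p' \<le> T * T'"
    by (rule power2_le_imp_le) (use T(1,2) in simp)
  moreover have "transverse c u x \<bullet> transverse c u w \<le> p * p'"
    unfolding p_def p'_def by (rule norm_cauchy_schwarz)
  moreover have "time_coord c x * time_coord c w - space_coord c x \<bullet> space_coord c w =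
      T * T' - transverse c u x \<bullet> transverse c u w"
    using lorentz_form_boost[OF assms(2), of c x w b] assms(5) by (simp add: T_def T'_def)
  ultimately have "k \<le> time_coord c x * time_coord c w - space_coord c x \<bullet> space_coord c w"
    by linarith
  then have "arcosh k \<le> arcosh (time_coord c x * time_coord c w - space_coord c x \<bullet> space_coord c w)"
    using k(1) by (rule arcosh_mono[rotated])
  then show ?thesis
    using assms(1) unfolding hyp_dist_eq_arcosh[OF assms(1,3,4)] k_def arcosh_sqrt_one_plus_square
    by (simp add: divide_right_mono)
qed

text \<open>Equality in both Cauchy-Schwarz estimates of \<open>arsinh_le_hyp_dist\<close> is
  reached by dropping the signed height of x and dividing the other boosted coordinates by
  \<open>k\<close>.\<close>

lemma perpendicular_foot:
  fixes u :: "'a::real_inner"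
  assumes "c > 0" "norm u = 1" "x \<in> poincare_ball c"
  obtains w where "w \<in> poincare_ball c" "signed_height c b u w = 0"
    "hyp_dist c x w = arsinh \<bar>signed_height c b u x\<bar> / sqrt c"
proof -
  have uu: "u \<bullet> u = 1"
    using assms by (simp add: norm_eq_1)
  define k where "k = sqrt (1 + (signed_height c b u x)\<^sup>2)"
  have k: "k > 0" "k\<^sup>2 = 1 + (signed_height c b u x)\<^sup>2"
    by (simp_all add: k_def add_pos_nonneg)
  define T P where "T = boosted_time c b u x" and "P = transverse c u x"
  have T: "0 < T" "T\<^sup>2 = k\<^sup>2 + P \<bullet> P"
    using boosted_time_pos[OF assms] boosted_time_square[OF assms]
    by (simp_all add: T_def P_def k power2_norm_eq_inner)
  have Pu: "P \<bullet> u = 0" "u \<bullet> P = 0"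
    by (simp_all add: P_def transverse_def inner_diff uu inner_commute)
  \<comment> \<open>In boosted coordinates the foot has time T / k, height 0 and transverse part P /
    k. Since T^2 - P . P = k^2, it lies on the hyperboloid; \<open>t\<close> and \<open>s\<close>
    undo the boost.\<close>
  define t where "t = cosh b * T / k"
  define s where "s = (sinh b * T / k) *\<^sub>R u + (1 / k) *\<^sub>R P"
  have "t > 0"
    using T k by (simp add: t_def)
  moreover have "(norm s)\<^sup>2 = t\<^sup>2 - 1"
  proof -
    have "(norm s)\<^sup>2 = (sinh b * T / k)\<^sup>2 + (P \<bullet> P) / k\<^sup>2"
      unfolding power2_norm_eq_inner s_def
      by (simp add: inner_add uu Pu power2_eq_square)
    also have "\<dots> = ((sinh b)\<^sup>2 * T\<^sup>2 + (T\<^sup>2 - k\<^sup>2)) / k\<^sup>2"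
      by (simp add: T(2) power_mult_distrib power_divide add_divide_distrib)
    also have "\<dots> = t\<^sup>2 - 1"
      using k(1) by (simp add: t_def power_mult_distrib power_divide cosh_square_eq field_simps)
    finally show ?thesis .
  qed
  ultimately obtain w where w: "w \<in> poincare_ball c" "time_coord c w = t" "space_coord c w = s"
    using hyperboloid_chart_surj[OF assms(1)] by blast
  have su: "s \<bullet> u = sinh b * T / k"
    by (simp add: s_def inner_add uu Pu)
  have height: "signed_height c b u w = 0"
    by (simp add: signed_height_def w su t_def)
  have "boosted_time c b u w = ((cosh b)\<^sup>2 - (sinh b)\<^sup>2) * T / k"
    unfolding boosted_time_def w su t_def by (simp add: power2_eq_square diff_divide_distrib left_diff_distrib)
  then have "boosted_time c b u w = T / k"
    by (simp add: cosh_square_eq)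
  moreover have "transverse c u w = (1 / k) *\<^sub>R P"
    unfolding transverse_def w su by (simp add: s_def)
  ultimately have "time_coord c x * time_coord c w - space_coord c x \<bullet> space_coord c w = (T\<^sup>2 - P \<bullet> P) / k"
    using lorentz_form_boost[OF assms(2), of c x w b] height
    by (simp add: T_def P_def power2_eq_square diff_divide_distrib)
  also have "\<dots> = k"
    unfolding T(2) using k(1) by (simp add: power2_eq_square)
  finally have "hyp_dist c x w = arsinh \<bar>signed_height c b u x\<bar> / sqrt c"
    unfolding hyp_dist_eq_arcosh[OF assms(1,3) w(1)] by (simp add: k_def arcosh_sqrt_one_plus_square)
  with w(1) height show ?thesis
    by (rule that)
qed

text \<open>The infimum is a minimum, attained at the foot of the perpendicular.\<close>

lemma hyp_setdist_level_set:
  fixes u :: "'a::real_inner"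
  assumes "c > 0" "norm u = 1" "x \<in> poincare_ball c"
  shows "hyp_setdist c x {w \<in> poincare_ball c. signed_height c b u w = 0} =
    arsinh \<bar>signed_height c b u x\<bar> / sqrt c"
proof -
  obtain w where "w \<in> poincare_ball c" "signed_height c b u w = 0"
    "hyp_dist c x w = arsinh \<bar>signed_height c b u x\<bar> / sqrt c"
    using perpendicular_foot[OF assms] by blast
  then show ?thesis
    unfolding hyp_setdist_def
    by (intro cInf_eq_minimum) (auto intro: arsinh_le_hyp_dist[OF assms] rev_image_eqI)
qed

section \<open>The Moebius hyperplane as a zero set of the signed height\<close>

lemma inner_mobius_add_eq_signed_height:
  fixes u :: "'a::real_inner" and s :: real
  assumes "c > 0" "norm u = 1" "x \<in> poincare_ball c"
  defines "q \<equiv> (tanh s / sqrt c) *\<^sub>R u"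
  obtains k where "k > 0" "u \<bullet> mobius_add c (- q) x = k * signed_height c (2 * s) u x"
proof -
  define D where "D = 1 + 2 * c * (- q \<bullet> x) + c\<^sup>2 * (norm (- q))\<^sup>2 * (norm x)\<^sup>2"
  have uu: "u \<bullet> u = 1"
    using assms by (simp add: norm_eq_1)
  have "(tanh s)\<^sup>2 < 1"
    using tanh_real_bounds[of s] by (simp add: abs_square_less_1 abs_less_iff)
  then have q: "q \<in> poincare_ball c"
    using assms(1,2) by (simp add: poincare_ball_def q_def power_mult_distrib power_divide)
  have D: "D > 0"
    unfolding D_def using assms by (intro mobius_denominator_pos minus_in_poincare_ball q) auto
  define E where "E = 1 - c * (norm x)\<^sup>2"
  have E: "E > 0"
    using assms(3) by (simp add: E_def poincare_ball_def)
  define X where "X = x \<bullet> u"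
  define N where "N = c * (norm x)\<^sup>2"
  define g where "g = sqrt c"
  have g: "g > 0" "c = g * g"
    using assms(1) by (simp_all add: g_def)
  define C S where "C = cosh s" and "S = sinh s"
  have C: "C > 0"
    by (simp add: C_def)
  have q_inner: "q \<bullet> x = tanh s / g * X" "u \<bullet> q = tanh s / g"
    by (simp_all add: q_def X_def g_def uu inner_commute[of x u])
  have q_norm: "c * (norm q)\<^sup>2 = (tanh s)\<^sup>2"
    using assms(1,2) by (simp add: q_def power_mult_distrib power_divide)
  have "D *\<^sub>R mobius_add c (- q) x = (1 - 2 * c * (q \<bullet> x) + N) *\<^sub>R (- q) + (1 - c * (norm q)\<^sup>2) *\<^sub>R x"
    using D unfolding D_def[symmetric] mobius_add_def by (simp add: N_def)
  then have "D * (u \<bullet> mobius_add c (- q) x)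
      = u \<bullet> ((1 - 2 * c * (q \<bullet> x) + N) *\<^sub>R (- q) + (1 - c * (norm q)\<^sup>2) *\<^sub>R x)"
    by (metis inner_scaleR_right)
  also have "\<dots> = (1 - (tanh s)\<^sup>2) * X - (1 - 2 * c * (q \<bullet> x) + N) * (tanh s / g)"
    unfolding inner_add_right inner_scaleR_right inner_minus_right q_norm q_inner(2)
    by (simp add: X_def inner_commute)
  also have "\<dots> = (1 - (S / C)\<^sup>2) * X - (1 - 2 * g * (S / C) * X + N) * (S / C / g)"
    unfolding q_inner(1) using g by (simp add: tanh_def C_def S_def)
  \<comment> \<open>The coefficient of X collects C^2 - S^2 from the factor 1 - tanh^2 and 2 S^2
    from the cross term.\<close>
  also have "\<dots> = ((C\<^sup>2 + S\<^sup>2) * g * X - (1 + N) * C * S) / (g * C\<^sup>2)"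
    using g(1) C by (simp add: field_simps power2_eq_square)
  \<comment> \<open>The factor is chosen so that 2 / E and (1 + N) / E become the conformal factor
    and the time coordinate. The combinations C^2 + S^2 and 2 S C are cosh and sinh of
    \<open>2 * s\<close>: the base point is at distance 2 |s| / sqrt c from the origin, hence the
    doubled rapidity.\<close>
  also have "\<dots> = E / (2 * g * C\<^sup>2) * ((C\<^sup>2 + S\<^sup>2) * (g * (2 / E) * X) - 2 * S * C * ((1 + N) / E))"
    using g(1) C E by (simp add: field_simps)
  also have "(C\<^sup>2 + S\<^sup>2) * (g * (2 / E) * X) - 2 * S * C * ((1 + N) / E) = signed_height c (2 * s) u x"
    unfolding signed_height_def time_coord_eq[OF assms(3)] space_coord_def conformal_factor_def
      cosh_double sinh_double E_def N_def g_def C_def S_def X_def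
    by simp
  finally have *: "D * (u \<bullet> mobius_add c (- q) x) = E / (2 * g * C\<^sup>2) * signed_height c (2 * s) u x" .
  define K where "K = E / (2 * g * C\<^sup>2)"
  have "K > 0"
    using E g(1) C by (simp add: K_def)
  moreover have "u \<bullet> mobius_add c (- q) x = K / D * signed_height c (2 * s) u x"
    using * D unfolding K_def[symmetric] by (simp add: nonzero_eq_divide_eq mult.commute)
  ultimately show ?thesis
    using D by (intro that[of "K / D"]) simp_all
qed

section \<open>The closed formula\<close>

theorem mainTheorem2:
  fixes c r :: real
    and z q a :: "real ^ 'n"
    and H :: "(real ^ 'n) set"
    and v :: "real ^ 'n \<Rightarrow> real"
  assumes "c > 0"
    and "z \<noteq> 0"
    and "q = (1 / sqrt c * tanh (sqrt c * r)) *\<^sub>R (z /\<^sub>R norm z)"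
    and "a = (1 / cosh (sqrt c * r))\<^sup>2 *\<^sub>R z"
    and "H = poincare_hyperplane c q a"
    and "\<And>x. x \<in> poincare_ball c \<Longrightarrow>
           v x = sgn (a \<bullet> mobius_add c (- q) x) * hyp_setdist c x H * (conformal_factor c q * norm a)"
  shows "\<forall>x \<in> poincare_ball c.
           v x = 2 * norm z / sqrt c *
             arsinh (conformal_factor c x * ((sqrt c *\<^sub>R x) \<bullet> (z /\<^sub>R norm z)) * cosh (2 * sqrt c * r)
                     - (conformal_factor c x - 1) * sinh (2 * sqrt c * r))"
proof
  fix x :: "real ^ 'n"
  assume x: "x \<in> poincare_ball c"
  define u where "u = z /\<^sub>R norm z"
  define s where "s = sqrt c * r"
  define C where "C = cosh s"
  have u: "norm u = 1" and z: "z = norm z *\<^sub>R u"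
    using assms(2) by (simp_all add: u_def)
  have q: "q = (tanh s / sqrt c) *\<^sub>R u"
    by (simp add: assms(3) s_def u_def)
  have C: "C > 0"
    by (simp add: C_def)
  have a: "a = (norm z / C\<^sup>2) *\<^sub>R u"
    unfolding assms(4) by (subst z) (simp add: C_def s_def power_divide)
  \<comment> \<open>Stated for every point of the ball because it has two uses: its zero case
    identifies \<open>H\<close>, and its value at \<open>x\<close> is the sign in
    \<open>v x\<close>.\<close>
  have sgn_eq: "sgn (a \<bullet> mobius_add c (- q) w) = sgn (signed_height c (2 * s) u w)"
    if w: "w \<in> poincare_ball c" for w
  proof -
    obtain k where "k > 0" "u \<bullet> mobius_add c (- q) w = k * signed_height c (2 * s) u w"
      using inner_mobius_add_eq_signed_height[OF assms(1) u w, of s] unfolding q by blast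
    then show ?thesis
      using C assms(2) by (simp add: a sgn_mult)
  qed
  have "H = {w \<in> poincare_ball c. signed_height c (2 * s) u w = 0}"
    unfolding assms(5) poincare_hyperplane_def
  proof (intro Collect_cong conj_cong refl)
    fix w :: "real ^ 'n"
    assume "w \<in> poincare_ball c"
    then show "a \<bullet> mobius_add c (- q) w = 0 \<longleftrightarrow> signed_height c (2 * s) u w = 0"
      using sgn_eq[of w] sgn_eq_0_iff by metis
  qed
  then have dist: "hyp_setdist c x H = arsinh \<bar>signed_height c (2 * s) u x\<bar> / sqrt c"
    using hyp_setdist_level_set[OF assms(1) u x] by simp
  have "c * (norm q)\<^sup>2 = (tanh s)\<^sup>2"
    using assms(1) u by (simp add: q power_mult_distrib power_divide)
  also have "\<dots> = 1 - 1 / C\<^sup>2"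
    using C by (simp add: tanh_def C_def[symmetric] power_divide field_simps sinh_square_eq)
  finally have "conformal_factor c q = 2 * C\<^sup>2"
    by (simp add: conformal_factor_def)
  \<comment> \<open>The conformal factor 2 cosh^2 at \<open>q\<close> cancels the sech^2 in
    \<open>a\<close>: parallel transport preserves the Riemannian norm, which at the origin is 2
    |z|.\<close>
  then have scale: "conformal_factor c q * norm a = 2 * norm z"
    using C u by (simp add: a)
  have "v x = sgn (signed_height c (2 * s) u x) * (arsinh \<bar>signed_height c (2 * s) u x\<bar> / sqrt c) * (2 * norm z)"
    using assms(6)[OF x] by (simp add: sgn_eq[OF x] dist scale)
  \<comment> \<open>Oddness of \<open>arsinh\<close> absorbs the sign and the absolute value; at
    height 0 both sides vanish.\<close>
  also have "\<dots> = 2 * norm z / sqrt c * arsinh (signed_height c (2 * s) u x)"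
    by (simp add: sgn_if abs_if arsinh_minus_real)
  also have "signed_height c (2 * s) u x =
      conformal_factor c x * ((sqrt c *\<^sub>R x) \<bullet> u) * cosh (2 * sqrt c * r)
        - (conformal_factor c x - 1) * sinh (2 * sqrt c * r)"
    by (simp add: signed_height_def space_coord_def time_coord_def s_def mult_ac)
  finally show "v x = 2 * norm z / sqrt c *
      arsinh (conformal_factor c x * ((sqrt c *\<^sub>R x) \<bullet> (z /\<^sub>R norm z)) * cosh (2 * sqrt c * r)
        - (conformal_factor c x - 1) * sinh (2 * sqrt c * r))"
    unfolding u_def .
qed

end
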